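(* For each modular subgroup $G$ (finite index subgroup of $\Gamma=\mathrm{PSL}_2(\mathbb{Z})$), the modular shift space $(\Sigma_G,\sigma)$ is finitely irreducible. That is, there exists a finite set $W\subset\Sigma_G^{\ast}$ such that for all $a,b\in\mathbb{Z}^{\times}\times E_G$ there exists $w\in W$ such that $awb\in\Sigma_G^{\ast}$.
   Context: $\mathbb{Z}^{\times}:=\mathbb{Z}\setminus\{0\}$. $S:z\mapsto-1/z$ and $T:z\mapsto z+1$ are the standard generators of $\Gamma=\mathrm{PSL}_2(\mathbb{Z})$. $E_G\subset\Gamma$ is a fixed (finite) set of representatives of the coset space $G\backslash\Gamma$, so $\Gamma$ is the disjoint union of the cosets $Ge$, $e\in E_G$. For $k\in\mathbb{Z}^{\times}$, the map $\tau_k:E_G\to E_G$ sends $e$ to the unique element of $E_G$ lying in the coset $G\,e\,ST^{k}$. $\Sigma_*:=\{(x_1,x_2,\ldots)\in(\mathbb{Z}^{\times})^{\mathbb{N}}: x_ix_{i+1}<0\text{ for all }i\in\mathbb{N}\}$. The modular shift space is $$\Sigma_G:=\{((x_1,e_1),(x_2,e_2),\ldots)\in(\mathbb{Z}^{\times}\times E_G)^{\mathbb{N}}:(x_1,x_2,\ldots)\in\Sigma_*,\ e_{k+1}=\tau_{x_k}(e_k)\text{ for all }k\in\mathbb{N}\},$$ with the left shift $\sigma$. $\Sigma_G^n$ is the set of admissible words of length $n$ in the alphabet $\mathbb{Z}^{\times}\times E_G$, i.e. words $(x_1,e_1)\cdots(x_n,e_n)$ with $x_ix_{i+1}<0$ and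 $e_{i+1}=\tau_{x_i}(e_i)$ for $1\le i<n$; $\Sigma_G^{\ast}:=\bigcup_{n\in\mathbb{N}}\Sigma_G^n$. Juxtaposition denotes concatenation of words. *)

theory Defs
  imports "HOL-Analysis.Determinants" "HOL-Algebra.Coset"
begin

definition SL2Z :: "(int^2^2) monoid" where
  "SL2Z = \<lparr>carrier = {A. det A = 1}, mult = (**), one = mat 1\<rparr>"

text \<open>An element of \<open>PSL2Z\<close> is a coset \<open>{A, - A}\<close>; it acts on the upper half-plane by
  the Moebius transformation of the matrix \<open>A\<close>, which does not change under \<open>A \<mapsto> - A\<close>.\<close>

definition PSL2Z :: "(int^2^2) set monoid" where
  "PSL2Z = SL2Z Mod {mat 1, - mat 1}"

definition moebius_class :: "int^2^2 \<Rightarrow> (int^2^2) set" where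
  "moebius_class A = {mat 1, - mat 1} #>\<^bsub>SL2Z\<^esub> A"

text \<open>The maps \<open>z \<mapsto> -1/z\<close> and \<open>z \<mapsto> z + 1\<close>.\<close>

definition S_gen :: "(int^2^2) set" where
  "S_gen = moebius_class (vector [vector [0, -1], vector [1, 0]])"

definition T_gen :: "(int^2^2) set" where
  "T_gen = moebius_class (vector [vector [1, 1], vector [0, 1]])"

definition modular_subgroup :: "(int^2^2) set set \<Rightarrow> bool" where
  "modular_subgroup G \<longleftrightarrow> subgroup G PSL2Z \<and> finite (rcosets\<^bsub>PSL2Z\<^esub> G)"

text \<open>In HOL-Algebra, \<open>G #> g\<close> is the coset written \<open>Gg\<close>, and \<open>rcosets G\<close> is the set of
  these, i.e. the coset space \<open>G\<setminus>PSL2Z\<close>.\<close>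

definition coset_representatives ::
    "(int^2^2) set set \<Rightarrow> (int^2^2) set set \<Rightarrow> bool" where
  "coset_representatives G E \<longleftrightarrow>
     E \<subseteq> carrier PSL2Z \<and> (\<forall>C \<in> rcosets\<^bsub>PSL2Z\<^esub> G. \<exists>!e. e \<in> E \<and> e \<in> C)"

definition tau ::
    "(int^2^2) set set \<Rightarrow> (int^2^2) set set \<Rightarrow> int \<Rightarrow> (int^2^2) set \<Rightarrow> (int^2^2) set" where
  "tau G E k e = (THE e'. e' \<in> E \<and>
     e' \<in> G #>\<^bsub>PSL2Z\<^esub> (e \<otimes>\<^bsub>PSL2Z\<^esub> (S_gen \<otimes>\<^bsub>PSL2Z\<^esub> (T_gen [^]\<^bsub>PSL2Z\<^esub> k))))"

definition alphabet :: "(int^2^2) set set \<Rightarrow> (int \<times> (int^2^2) set) set" where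
  "alphabet E = {x. x \<noteq> 0} \<times> E"

text \<open>Sequences and words are indexed from \<open>0\<close> instead of \<open>1\<close>.\<close>

definition modular_shift ::
    "(int^2^2) set set \<Rightarrow> (int^2^2) set set \<Rightarrow> (nat \<Rightarrow> int \<times> (int^2^2) set) set" where
  "modular_shift G E = {s. (\<forall>i. s i \<in> alphabet E) \<and>
     (\<forall>i. fst (s i) * fst (s (Suc i)) < 0 \<and>
          snd (s (Suc i)) = tau G E (fst (s i)) (snd (s i)))}"

definition admissible_words_of_length ::
    "(int^2^2) set set \<Rightarrow> (int^2^2) set set \<Rightarrow> nat \<Rightarrow> (int \<times> (int^2^2) set) list set" where
  "admissible_words_of_length G E n = {w. length w = n \<and> set w \<subseteq> alphabet E \<and>
     (\<forall>i. Suc i < n \<longrightarrow> fst (w ! i) * fst (w ! Suc i) < 0 \<and>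
          snd (w ! Suc i) = tau G E (fst (w ! i)) (snd (w ! i)))}"

text \<open>The empty word is excluded, since \<open>n\<close> ranges over the positive integers.\<close>

definition admissible_words ::
    "(int^2^2) set set \<Rightarrow> (int^2^2) set set \<Rightarrow> (int \<times> (int^2^2) set) list set" where
  "admissible_words G E = (\<Union>n \<in> {1..}. admissible_words_of_length G E n)"

lemma group_SL2Z: "group SL2Z"
proof (rule groupI)
  fix A assume "A \<in> carrier SL2Z"
  then have d: "A$1$1 * A$2$2 - A$1$2 * A$2$1 = 1"
    by (simp add: SL2Z_def det_2)
  let ?B = "vector [vector [A$2$2, - A$1$2], vector [- A$2$1, A$1$1]] :: int^2^2"
  have "?B ** A = mat 1" "det ?B = 1"
    using d by (simp_all add: matrix_matrix_mult_def mat_def vec_eq_iff forall_2 sum_2 det_2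
        algebra_simps)
  then show "\<exists>B\<in>carrier SL2Z. B \<otimes>\<^bsub>SL2Z\<^esub> A = \<one>\<^bsub>SL2Z\<^esub>"
    by (auto simp: SL2Z_def)
qed (auto simp: SL2Z_def det_mul matrix_mul_assoc)

lemma neg_mat_mult:
  fixes A :: "int^2^2"
  shows "(- mat 1) ** A = - A" "A ** (- mat 1) = - A"
  by (simp_all add: matrix_matrix_mult_def mat_def vec_eq_iff forall_2 sum_2)

lemma det_neg_mat: "det (- mat 1 :: int^2^2) = 1"
  by (simp add: det_2 mat_def)

lemma normal_pm1: "{mat 1, - mat 1} \<lhd> SL2Z"
proof -
  interpret group SL2Z by (rule group_SL2Z)
  have sub: "subgroup {mat 1, - mat 1} SL2Z"
  proof (rule subgroupI)
    fix a assume a: "a \<in> {mat 1, - mat 1 :: int^2^2}"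
    then have "a \<otimes>\<^bsub>SL2Z\<^esub> a = \<one>\<^bsub>SL2Z\<^esub>" "a \<in> carrier SL2Z"
      by (auto simp: SL2Z_def neg_mat_mult det_neg_mat)
    then have "inv\<^bsub>SL2Z\<^esub> a = a" by (simp add: inv_equality)
    then show "inv\<^bsub>SL2Z\<^esub> a \<in> {mat 1, - mat 1}" using a by simp
  qed (auto simp: SL2Z_def neg_mat_mult det_neg_mat)
  show ?thesis
    by (rule normalI[OF sub]) (auto simp: r_coset_def l_coset_def SL2Z_def neg_mat_mult)
qed

lemma group_PSL2Z: "group PSL2Z"
  unfolding PSL2Z_def by (rule normal.factorgroup_is_group[OF normal_pm1])

lemma moebius_class_eq: "moebius_class A = {A, - A}"
  by (auto simp: moebius_class_def r_coset_def SL2Z_def neg_mat_mult)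

lemma S_T_carrier: "S_gen \<in> carrier PSL2Z" "T_gen \<in> carrier PSL2Z"
proof -
  have "moebius_class A \<in> carrier PSL2Z" if "det A = 1" for A
    using that by (auto simp: PSL2Z_def FactGroup_def RCOSETS_def moebius_class_def SL2Z_def)
  then show "S_gen \<in> carrier PSL2Z" "T_gen \<in> carrier PSL2Z"
    by (simp_all add: S_gen_def T_gen_def det_2)
qed

lemma tau_in_coset:
  assumes "modular_subgroup G" "coset_representatives G E" "e \<in> E"
  shows "tau G E k e \<in> E"
    and "tau G E k e \<in>
      G #>\<^bsub>PSL2Z\<^esub> (e \<otimes>\<^bsub>PSL2Z\<^esub> (S_gen \<otimes>\<^bsub>PSL2Z\<^esub> (T_gen [^]\<^bsub>PSL2Z\<^esub> k)))"
proof -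
  interpret group PSL2Z by (rule group_PSL2Z)
  let ?g = "e \<otimes>\<^bsub>PSL2Z\<^esub> (S_gen \<otimes>\<^bsub>PSL2Z\<^esub> (T_gen [^]\<^bsub>PSL2Z\<^esub> k))"
  have "?g \<in> carrier PSL2Z"
    using assms S_T_carrier by (auto simp: coset_representatives_def)
  moreover have "G \<subseteq> carrier PSL2Z"
    using assms by (simp add: modular_subgroup_def subgroup.subset)
  ultimately have "G #>\<^bsub>PSL2Z\<^esub> ?g \<in> rcosets\<^bsub>PSL2Z\<^esub> G" by (rule rcosetsI[rotated])
  then have "\<exists>!e'. e' \<in> E \<and> e' \<in> G #>\<^bsub>PSL2Z\<^esub> ?g"
    using assms(2) by (simp add: coset_representatives_def)
  from theI'[OF this] show "tau G E k e \<in> E" "tau G E k e \<in> G #>\<^bsub>PSL2Z\<^esub> ?g"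
    by (auto simp: tau_def)
qed

lemma admissible_words_of_length_eq_initial_words:
  assumes "modular_subgroup G" "coset_representatives G E" "n \<ge> 1"
  shows "admissible_words_of_length G E n = (\<lambda>s. map s [0..<n]) ` modular_shift G E"
proof (intro equalityI subsetI)
  fix w assume w: "w \<in> admissible_words_of_length G E n"
  have len: "length w = n" and alph: "\<And>i. i < n \<Longrightarrow> w ! i \<in> alphabet E"
    using w by (auto simp: admissible_words_of_length_def)
  define s where "s = rec_nat (w ! 0) (\<lambda>i p. if Suc i < n then w ! Suc i
      else (- fst p, tau G E (fst p) (snd p)))"
  have s0: "s 0 = w ! 0" and sS: "s (Suc i) = (if Suc i < n then w ! Suc i
      else (- fst (s i), tau G E (fst (s i)) (snd (s i))))" for i
    by (simp_all add: s_def)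
  have sw: "s i = w ! i" if "i < n" for i
    using that by (cases i) (simp_all add: s0 sS)
  have sa: "s i \<in> alphabet E" for i
  proof (induction i)
    case 0
    then show ?case using assms(3) alph by (simp add: s0)
  next
    case (Suc i)
    then show ?case using alph tau_in_coset(1)[OF assms(1,2)]
      by (auto simp: sS alphabet_def mem_Times_iff)
  qed
  have "fst (s i) * fst (s (Suc i)) < 0 \<and>
      snd (s (Suc i)) = tau G E (fst (s i)) (snd (s i))" for i
  proof (cases "Suc i < n")
    case True
    then show ?thesis using w by (simp add: sw admissible_words_of_length_def)
  next
    case False
    have "fst (s i) \<noteq> 0" using sa[of i] by (auto simp: alphabet_def)
    then have "fst (s i) * - fst (s i) < 0" by (auto simp: zero_less_mult_iff mult_less_0_iff linorder_neq_iff)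
    then show ?thesis using False by (simp add: sS)
  qed
  then have "s \<in> modular_shift G E" using sa by (simp add: modular_shift_def)
  moreover have "w = map s [0..<n]" using len sw by (auto intro: nth_equalityI)
  ultimately show "w \<in> (\<lambda>s. map s [0..<n]) ` modular_shift G E" by blast
next
  fix w assume "w \<in> (\<lambda>s. map s [0..<n]) ` modular_shift G E"
  then show "w \<in> admissible_words_of_length G E n"
    by (auto simp: modular_shift_def admissible_words_of_length_def)
qed

end

theory Submission
  imports Defs
begin

text \<open>Since \<open>T\<close> permutes the finitely many cosets of \<open>G\<close>, every letter \<open>k\<close>, even \<open>k = 0\<close>, can
  be replaced at a given coset by a letter of either prescribed sign with the same transition.
  So the sign condition costs nothing, except that the signs at the two ends of a word fix
  the parity of its length. Transitivity holds because the elements \<open>S T\<^sup>k\<close> generate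
  \<open>PSL2Z\<close> as a monoid (Euclidean algorithm), and the parity is adjusted by the relations
  \<open>S\<^sup>2 = 1\<close> and \<open>(S T)\<^sup>3 = 1\<close>, of lengths two and three. A connecting word depends only on the two
  cosets and the two signs at its ends, so finitely many words suffice.\<close>

section \<open>Generation of the modular group\<close>

interpretation PSL2Z: group PSL2Z
  by (rule group_PSL2Z)

lemma moebius_class_closed: "det A = 1 \<Longrightarrow> moebius_class A \<in> carrier PSL2Z"
  by (auto simp: PSL2Z_def FactGroup_def RCOSETS_def moebius_class_def SL2Z_def)

lemma carrier_PSL2Z_cases:
  assumes "x \<in> carrier PSL2Z"
  obtains A where "det A = 1" "x = moebius_class A"
  using assms by (auto simp: PSL2Z_def FactGroup_def RCOSETS_def moebius_class_def SL2Z_def)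

text \<open>Normality of \<open>{mat 1, - mat 1}\<close> makes the product of cosets the coset of
  the product, so computations in \<open>PSL2Z\<close> reduce to integer matrices.\<close>

lemma moebius_class_mult:
  assumes "det A = 1" "det B = 1"
  shows "moebius_class A \<otimes>\<^bsub>PSL2Z\<^esub> moebius_class B = moebius_class (A ** B)"
  using normal.rcos_sum[OF normal_pm1, of A B] assms
  by (simp add: moebius_class_def PSL2Z_def FactGroup_def SL2Z_def)

lemma moebius_class_uminus: "moebius_class (- A) = moebius_class A"
  by (auto simp: moebius_class_eq)

lemma one_PSL2Z: "\<one>\<^bsub>PSL2Z\<^esub> = moebius_class (mat 1)"
  by (simp add: PSL2Z_def FactGroup_def moebius_class_eq)

lemma T_gen_int_pow:
  "T_gen [^]\<^bsub>PSL2Z\<^esub> (k::int) = moebius_class (vector [vector [1, k], vector [0, 1]])"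
proof -
  let ?h = "\<lambda>k::int. moebius_class (vector [vector [1, k], vector [0, 1]])"
  have h_add: "?h k \<otimes>\<^bsub>PSL2Z\<^esub> ?h l = ?h (k + l)" for k l
    by (simp add: moebius_class_mult det_2)
      (rule arg_cong[where f = moebius_class],
        simp add: vec_eq_iff forall_2 matrix_matrix_mult_def sum_2)
  have T: "T_gen = ?h 1"
    by (simp add: T_gen_def)
  have hom: "?h k \<in> carrier PSL2Z" for k
    by (simp add: moebius_class_closed det_2)
  show ?thesis
  proof (induction k rule: int_induct[where k = 0])
    case base
    have "(vector [vector [1, 0], vector [0, 1]] :: int^2^2) = mat 1"
      by (simp add: vec_eq_iff forall_2 mat_def)
    then show ?case
      by (simp add: one_PSL2Z)
  next
    case (step1 i)
    then show ?case
      using h_add[of i 1] S_T_carrier(2) by (simp add: PSL2Z.int_pow_mult T[symmetric])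
  next
    case (step2 i)
    \<comment> \<open>Going down, both sides are compared after right multiplication by
      \<open>T_gen\<close>, which then cancels.\<close>
    have "T_gen [^]\<^bsub>PSL2Z\<^esub> (i - 1) \<otimes>\<^bsub>PSL2Z\<^esub> T_gen = T_gen [^]\<^bsub>PSL2Z\<^esub> i"
      using S_T_carrier(2) PSL2Z.int_pow_mult[of T_gen "i - 1" 1] by simp
    also have "\<dots> = ?h (i - 1) \<otimes>\<^bsub>PSL2Z\<^esub> T_gen"
      using step2 h_add[of "i - 1" 1] by (simp add: T)
    finally show ?case
      using S_T_carrier(2) hom PSL2Z.int_pow_closed by (simp only: PSL2Z.right_cancel)
  qed
qed

section \<open>Products of the elements \<open>S T^k\<close>\<close>

abbreviation ST :: "int \<Rightarrow> (int^2^2) set" where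
  "ST k \<equiv> S_gen \<otimes>\<^bsub>PSL2Z\<^esub> (T_gen [^]\<^bsub>PSL2Z\<^esub> k)"

lemma ST_eq: "ST k = moebius_class (vector [vector [0, -1], vector [1, k]])"
  by (simp add: T_gen_int_pow S_gen_def moebius_class_mult det_2)
    (rule arg_cong[where f = moebius_class],
      simp add: vec_eq_iff forall_2 matrix_matrix_mult_def sum_2)

lemma ST_closed: "ST k \<in> carrier PSL2Z"
  using S_T_carrier by simp

text \<open>The letter 0 is allowed here although it is not in the alphabet;
  \<open>tau_prescribed_sign\<close> later replaces it by nonzero letters.\<close>

primrec ST_prod :: "int list \<Rightarrow> (int^2^2) set" where
  "ST_prod [] = \<one>\<^bsub>PSL2Z\<^esub>"
| "ST_prod (k # ks) = ST k \<otimes>\<^bsub>PSL2Z\<^esub> ST_prod ks"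

lemma ST_prod_closed: "ST_prod ks \<in> carrier PSL2Z"
  by (induction ks) (simp_all add: S_T_carrier)

lemma ST_prod_append: "ST_prod (ks @ ls) = ST_prod ks \<otimes>\<^bsub>PSL2Z\<^esub> ST_prod ls"
  by (induction ks) (simp_all add: ST_closed ST_prod_closed PSL2Z.m_assoc)

text \<open>Since \<open>S^2 = 1\<close>, the product is \<open>T^k\<close>; the matrices give this
  only up to the sign that the class forgets.\<close>

lemma ST_prod_0_k:
  "ST_prod [0, k] = moebius_class (vector [vector [1, k], vector [0, 1]])"
proof -
  have "(vector [vector [0, -1], vector [1, 0]] :: int^2^2) ** vector [vector [0, -1], vector [1, k]]
      = - (vector [vector [1, k], vector [0, 1]] :: int^2^2)"
    by (simp add: vec_eq_iff forall_2 matrix_matrix_mult_def sum_2)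
  then have "ST 0 \<otimes>\<^bsub>PSL2Z\<^esub> ST k = moebius_class (vector [vector [1, k], vector [0, 1]])"
    unfolding ST_eq by (simp add: moebius_class_mult moebius_class_uminus det_2)
  then show ?thesis
    using ST_closed[of k] by (simp only: ST_prod.simps PSL2Z.r_one)
qed

lemma ST_prod_0_0: "ST_prod [0, 0] = \<one>\<^bsub>PSL2Z\<^esub>"
proof -
  have "(vector [vector [1, 0], vector [0, 1]] :: int^2^2) = mat 1"
    by (simp add: vec_eq_iff forall_2 mat_def)
  then show ?thesis
    by (simp only: ST_prod_0_k one_PSL2Z)
qed

lemma ST_prod_1_1_1: "ST_prod [1, 1, 1] = \<one>\<^bsub>PSL2Z\<^esub>"
proof -
  let ?A = "vector [vector [0, -1], vector [1, 1]] :: int^2^2"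
  have A: "det ?A = 1"
    by (simp add: det_2)
  have "?A ** (?A ** ?A) = - mat 1"
    by (simp add: vec_eq_iff forall_2 matrix_matrix_mult_def sum_2 mat_def)
  then have "ST 1 \<otimes>\<^bsub>PSL2Z\<^esub> (ST 1 \<otimes>\<^bsub>PSL2Z\<^esub> ST 1) = \<one>\<^bsub>PSL2Z\<^esub>"
    unfolding ST_eq one_PSL2Z using A by (simp add: moebius_class_mult det_mul moebius_class_uminus)
  then show ?thesis
    using ST_closed[of 1] by (simp only: ST_prod.simps PSL2Z.r_one)
qed

text \<open>Euclidean algorithm on the first column: left multiplication by a suitable
  \<open>ST k\<close> shrinks the absolute value of the lower left entry, until it is 0 and the
  matrix is a power of T up to sign.\<close>

lemma moebius_class_ST_prod:
  assumes "det A = 1"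
  shows "\<exists>ks. moebius_class A = ST_prod ks"
  using assms
proof (induction "nat \<bar>A$2$1\<bar>" arbitrary: A rule: less_induct)
  case less
  have d: "A$1$1 * A$2$2 - A$1$2 * A$2$1 = 1"
    using less.prems by (simp add: det_2)
  show ?case
  proof (cases "A$2$1 = 0")
    case True
    then have "A$1$1 = 1 \<and> A$2$2 = 1 \<or> A$1$1 = -1 \<and> A$2$2 = -1"
      using d zmult_eq_1_iff by simp
    then have "A = vector [vector [1, A$1$2], vector [0, 1]] \<or>
        A = - vector [vector [1, - A$1$2], vector [0, 1]]"
      using True by (auto simp: vec_eq_iff forall_2)
    then show ?thesis
      by (metis ST_prod_0_k moebius_class_uminus)
  next
    case False
    \<comment> \<open>With this quotient the lower left entry of \<open>?B ** A\<close> is the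
      remainder of \<open>A$1$1\<close> modulo \<open>A$2$1\<close>.\<close>
    define k where "k = - (A$1$1 div A$2$1)"
    let ?B = "vector [vector [0, -1], vector [1, k]] :: int^2^2"
    have B: "det ?B = 1"
      by (simp add: det_2)
    have "(?B ** A)$2$1 = A$1$1 mod A$2$1"
      by (simp add: matrix_matrix_mult_def sum_2 k_def minus_div_mult_eq_mod[symmetric])
    then have "nat \<bar>(?B ** A)$2$1\<bar> < nat \<bar>A$2$1\<bar>"
      using False abs_mod_less[of "A$2$1" "A$1$1"] by simp
    from less.hyps[OF this] obtain ks where ks: "moebius_class (?B ** A) = ST_prod ks"
      using B less.prems by (auto simp: det_mul)
    \<comment> \<open>The inverse of \<open>ST k\<close> is \<open>T^(-k) S\<close>, itself the
      product for \<open>[0, -k, 0]\<close>. This is why the monoid generated by these elements is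
      the whole group.\<close>
    have "ST_prod [0, -k, 0, k] = ST_prod [0, -k] \<otimes>\<^bsub>PSL2Z\<^esub> ST_prod [0, k]"
      using ST_prod_append[of "[0, -k]" "[0, k]"] by simp
    also have "\<dots> = \<one>\<^bsub>PSL2Z\<^esub>"
      unfolding ST_prod_0_k T_gen_int_pow[symmetric]
      by (simp add: S_T_carrier flip: PSL2Z.int_pow_mult)
    finally have "moebius_class A = ST_prod ([0, -k, 0] @ [k]) \<otimes>\<^bsub>PSL2Z\<^esub> moebius_class A"
      using less.prems by (simp add: moebius_class_closed)
    also have "\<dots> = ST_prod [0, -k, 0] \<otimes>\<^bsub>PSL2Z\<^esub> (ST k \<otimes>\<^bsub>PSL2Z\<^esub> moebius_class A)"
      unfolding ST_prod_append using less.prems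
      by (simp add: moebius_class_closed ST_prod_closed ST_closed PSL2Z.m_assoc S_T_carrier)
    also have "ST k \<otimes>\<^bsub>PSL2Z\<^esub> moebius_class A = ST_prod ks"
      using ks B less.prems by (simp add: ST_eq moebius_class_mult)
    finally show ?thesis
      by (metis ST_prod_append)
  qed
qed

section \<open>Words connecting two cosets\<close>

locale modular_coset_space =
  fixes G E :: "(int^2^2) set set"
  assumes G: "modular_subgroup G"
    and E: "coset_representatives G E"
begin

lemma subgroup_G: "subgroup G PSL2Z"
  using G by (simp add: modular_subgroup_def)

lemma G_subset: "G \<subseteq> carrier PSL2Z"
  using subgroup_G by (rule subgroup.subset)

lemma E_closed: "e \<in> E \<Longrightarrow> e \<in> carrier PSL2Z"
  using E by (auto simp: coset_representatives_def)

lemma rcoset_in_rcosets: "g \<in> carrier PSL2Z \<Longrightarrow> G #>\<^bsub>PSL2Z\<^esub> g \<in> rcosets\<^bsub>PSL2Z\<^esub> G"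
  using G_subset by (rule PSL2Z.rcosetsI)

lemma finite_rcosets: "finite (rcosets\<^bsub>PSL2Z\<^esub> G)"
  using G by (simp add: modular_subgroup_def)

lemma representative_unique:
  assumes "e \<in> E" "e' \<in> E" "G #>\<^bsub>PSL2Z\<^esub> e = G #>\<^bsub>PSL2Z\<^esub> e'"
  shows "e = e'"
proof -
  have "e \<in> G #>\<^bsub>PSL2Z\<^esub> e" "e' \<in> G #>\<^bsub>PSL2Z\<^esub> e"
    using assms E_closed PSL2Z.rcos_self[OF _ subgroup_G] by auto
  moreover have "\<exists>!x. x \<in> E \<and> x \<in> G #>\<^bsub>PSL2Z\<^esub> e"
    using E rcoset_in_rcosets[OF E_closed[OF assms(1)]]
    unfolding coset_representatives_def by blast
  ultimately show ?thesis
    using assms(1,2) by blast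
qed

lemma finite_E: "finite E"
proof (rule finite_imageD)
  show "finite ((\<lambda>e. G #>\<^bsub>PSL2Z\<^esub> e) ` E)"
    by (rule finite_subset[OF _ finite_rcosets]) (auto intro: rcoset_in_rcosets E_closed)
  show "inj_on (\<lambda>e. G #>\<^bsub>PSL2Z\<^esub> e) E"
    by (rule inj_onI) (rule representative_unique)
qed

lemma rcoset_mult_cong:
  assumes "G #>\<^bsub>PSL2Z\<^esub> x = G #>\<^bsub>PSL2Z\<^esub> y"
    and "x \<in> carrier PSL2Z" "y \<in> carrier PSL2Z" "z \<in> carrier PSL2Z"
  shows "G #>\<^bsub>PSL2Z\<^esub> (x \<otimes>\<^bsub>PSL2Z\<^esub> z) = G #>\<^bsub>PSL2Z\<^esub> (y \<otimes>\<^bsub>PSL2Z\<^esub> z)"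
  using assms G_subset by (metis PSL2Z.coset_mult_assoc)

lemma tau_closed: "e \<in> E \<Longrightarrow> tau G E k e \<in> E"
  by (rule tau_in_coset(1)[OF G E])

lemma rcoset_tau:
  assumes "e \<in> E"
  shows "G #>\<^bsub>PSL2Z\<^esub> tau G E k e = G #>\<^bsub>PSL2Z\<^esub> (e \<otimes>\<^bsub>PSL2Z\<^esub> ST k)"
  using PSL2Z.repr_independence[OF tau_in_coset(2)[OF G E assms] _ subgroup_G]
    assms E_closed S_T_carrier by simp

text \<open>Pigeonhole: infinitely many powers of T meet finitely many cosets, so two agree, and
  their difference can be added to \<open>k\<close> without changing the coset.\<close>

lemma tau_prescribed_sign:
  assumes e: "e \<in> E" and s: "s \<in> {1, -1}"
  obtains k' where "sgn k' = s" "tau G E k' e = tau G E k e"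
proof -
  \<comment> \<open>As \<open>m\<close> exceeds the absolute value of \<open>k\<close>, a shift by
    any positive multiple of \<open>s * m\<close> forces the sign \<open>s\<close>.\<close>
  define m where "m = \<bar>k\<bar> + 1"
  let ?T = "\<lambda>k::int. T_gen [^]\<^bsub>PSL2Z\<^esub> k"
  let ?g = "e \<otimes>\<^bsub>PSL2Z\<^esub> S_gen"
  have closed: "?g \<in> carrier PSL2Z" "\<And>k. ?T k \<in> carrier PSL2Z"
    using e E_closed S_T_carrier by simp_all
  let ?f = "\<lambda>j::nat. G #>\<^bsub>PSL2Z\<^esub> (?g \<otimes>\<^bsub>PSL2Z\<^esub> ?T (- s * int j * m))"
  have "range ?f \<subseteq> rcosets\<^bsub>PSL2Z\<^esub> G"
    using closed by (auto intro!: rcoset_in_rcosets)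
  then have "\<not> inj ?f"
    using finite_rcosets finite_subset range_inj_infinite by blast
  then obtain i j where ij: "i < j" "?f i = ?f j"
    by (metis (no_types, lifting) linorder_injI)
  let ?k' = "k + s * (int j - int i) * m"
  have "m > 0" "m > \<bar>k\<bar>" "int j - int i \<ge> 1"
    using ij by (auto simp: m_def)
  then have "\<bar>k\<bar> < (int j - int i) * m"
    using mult_right_mono[of 1 "int j - int i" m] by linarith
  then have sgn: "sgn ?k' = s"
    using s by (auto simp: sgn_1_neg left_diff_distrib)
  \<comment> \<open>The common factor \<open>T^(k + s j m)\<close> turns the coset of index j into
    that of \<open>k\<close> and the one of index i into that of \<open>?k'\<close>.\<close>
  have "G #>\<^bsub>PSL2Z\<^esub> (e \<otimes>\<^bsub>PSL2Z\<^esub> ST ?k') = G #>\<^bsub>PSL2Z\<^esub> (e \<otimes>\<^bsub>PSL2Z\<^esub> ST k)"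
    using rcoset_mult_cong[OF ij(2), of "?T (k + s * int j * m)"] closed e E_closed S_T_carrier
    by (simp add: PSL2Z.m_assoc algebra_simps flip: PSL2Z.int_pow_mult)
  then have "tau G E ?k' e = tau G E k e"
    by (simp add: tau_def)
  with sgn show ?thesis
    by (rule that)
qed

section \<open>Walks on the coset representatives, without sign conditions\<close>

definition run :: "(int^2^2) set \<Rightarrow> int list \<Rightarrow> (int^2^2) set" where
  "run e ks = foldl (\<lambda>e k. tau G E k e) e ks"

lemma run_simps [simp]: "run e [] = e" "run e (k # ks) = run (tau G E k e) ks"
  by (simp_all add: run_def)

lemma run_closed: "e \<in> E \<Longrightarrow> run e ks \<in> E"
  by (induction ks arbitrary: e) (simp_all add: tau_closed)

text \<open>Each letter multiplies the coset from the right, so the factors appear in reading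
  order.\<close>

lemma rcoset_run:
  assumes "e \<in> E"
  shows "G #>\<^bsub>PSL2Z\<^esub> run e ks = G #>\<^bsub>PSL2Z\<^esub> (e \<otimes>\<^bsub>PSL2Z\<^esub> ST_prod ks)"
  using assms
proof (induction ks arbitrary: e)
  case Nil
  then show ?case by (simp add: E_closed)
next
  case (Cons k ks)
  have "G #>\<^bsub>PSL2Z\<^esub> run e (k # ks) = G #>\<^bsub>PSL2Z\<^esub> (tau G E k e \<otimes>\<^bsub>PSL2Z\<^esub> ST_prod ks)"
    using Cons tau_closed by simp
  also have "\<dots> = G #>\<^bsub>PSL2Z\<^esub> (e \<otimes>\<^bsub>PSL2Z\<^esub> ST k \<otimes>\<^bsub>PSL2Z\<^esub> ST_prod ks)"
    using rcoset_mult_cong[OF rcoset_tau[OF Cons.prems]] Cons.prems tau_closed E_closed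
      ST_closed ST_prod_closed by simp
  also have "e \<otimes>\<^bsub>PSL2Z\<^esub> ST k \<otimes>\<^bsub>PSL2Z\<^esub> ST_prod ks = e \<otimes>\<^bsub>PSL2Z\<^esub> ST_prod (k # ks)"
    using Cons.prems E_closed ST_closed[of k] ST_prod_closed[of ks] PSL2Z.m_assoc by simp
  finally show ?case .
qed

lemma run_eqI:
  assumes "e \<in> E" "f \<in> E" "e \<otimes>\<^bsub>PSL2Z\<^esub> ST_prod ks = f"
  shows "run e ks = f"
  using assms rcoset_run by (metis representative_unique run_closed)

text \<open>The trivial products for \<open>[0, 0]\<close> and \<open>[1, 1, 1]\<close> serve as
  prefixes: exactly one of them yields the parity \<open>b\<close>, and either makes the walk
  nonempty.\<close>

lemma run_transitive:
  assumes e: "e \<in> E" and f: "f \<in> E"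
  obtains ks where "ks \<noteq> []" "even (length ks) = b" "run e ks = f"
proof -
  have "inv\<^bsub>PSL2Z\<^esub> e \<otimes>\<^bsub>PSL2Z\<^esub> f \<in> carrier PSL2Z"
    using e f E_closed by simp
  then obtain ks where "inv\<^bsub>PSL2Z\<^esub> e \<otimes>\<^bsub>PSL2Z\<^esub> f = ST_prod ks"
    by (metis carrier_PSL2Z_cases moebius_class_ST_prod)
  then have ks: "e \<otimes>\<^bsub>PSL2Z\<^esub> ST_prod ks = f"
    using e f E_closed by (metis PSL2Z.inv_solve_left' ST_prod_closed)
  have "e \<otimes>\<^bsub>PSL2Z\<^esub> ST_prod ([0, 0] @ ks) = f" "e \<otimes>\<^bsub>PSL2Z\<^esub> ST_prod ([1, 1, 1] @ ks) = f"
    unfolding ST_prod_append ST_prod_0_0 ST_prod_1_1_1 using ks ST_prod_closed by simp_all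
  then have "run e ([0, 0] @ ks) = f" "run e ([1, 1, 1] @ ks) = f"
    using run_eqI e f by blast+
  then show ?thesis
    using that[of "[0, 0] @ ks"] that[of "[1, 1, 1] @ ks"] by (cases "even (length ks) = b") auto
qed

section \<open>Admissible words with prescribed ends\<close>

definition follows :: "int \<times> (int^2^2) set \<Rightarrow> int \<times> (int^2^2) set \<Rightarrow> bool" where
  "follows p q \<longleftrightarrow> fst p * fst q < 0 \<and> snd q = tau G E (fst p) (snd p)"

text \<open>Replaces indices by \<open>successively\<close>, whose rules for \<open>#\<close> and
  \<open>@\<close> suit building words by prefixing and concatenation.\<close>

lemma admissible_words_iff:
  "w \<in> admissible_words G E \<longleftrightarrow> w \<noteq> [] \<and> set w \<subseteq> alphabet E \<and> successively follows w"
  by (auto simp: admissible_words_def admissible_words_of_length_def successively_conv_nth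
      follows_def Suc_le_eq)

text \<open>Letters are replaced one by one with alternating signs, starting from \<open>s\<close>,
  without changing the walk; the last sign then depends only on the parity of the length.\<close>

lemma admissible_word_of_run:
  assumes "e \<in> E" "s \<in> {1, -1}" "ks \<noteq> []"
  shows "\<exists>w \<in> admissible_words G E.
    snd (hd w) = e \<and> sgn (fst (hd w)) = s \<and>
    tau G E (fst (last w)) (snd (last w)) = run e ks \<and>
    sgn (fst (last w)) = (if even (length ks) then - s else s)"
  using assms
proof (induction ks arbitrary: e s)
  case Nil
  then show ?case by simp
next
  case (Cons k ks)
  obtain k' where k': "sgn k' = s" "tau G E k' e = tau G E k e"
    using tau_prescribed_sign Cons.prems by metis
  have alph: "(k', e) \<in> alphabet E"
    using k' Cons.prems by (auto simp: alphabet_def)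
  show ?case
  proof (cases "ks = []")
    case True
    then show ?thesis
      using k' alph by (intro bexI[of _ "[(k', e)]"]) (auto simp: admissible_words_iff)
  next
    case False
    have "tau G E k e \<in> E" "- s \<in> {1, -1}"
      using Cons.prems tau_closed by auto
    from Cons.IH[OF this False] obtain w where w: "w \<in> admissible_words G E"
      "snd (hd w) = tau G E k e" "sgn (fst (hd w)) = - s"
      "tau G E (fst (last w)) (snd (last w)) = run (tau G E k e) ks"
      "sgn (fst (last w)) = (if even (length ks) then s else - s)"
      by auto
    have "sgn (k' * fst (hd w)) = - 1"
      using w(3) k'(1) Cons.prems by (auto simp: sgn_mult)
    then have "follows (k', e) (hd w)"
      using w(2) k'(2) by (simp only: follows_def sgn_1_neg fst_conv snd_conv)
    then have "(k', e) # w \<in> admissible_words G E"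
      using w(1) alph by (auto simp: admissible_words_iff successively_Cons)
    then show ?thesis
      using w k' Cons.prems
      by (intro bexI[of _ "(k', e) # w"]) (auto simp: admissible_words_iff)
  qed
qed

text \<open>The representative \<open>f\<close> is the one reached after the last letter, hence the
  one required of a following letter; \<open>e\<close> belongs to the first letter itself.\<close>

definition connects ::
    "(int^2^2) set \<Rightarrow> int \<Rightarrow> (int^2^2) set \<Rightarrow> int \<Rightarrow> (int \<times> (int^2^2) set) list \<Rightarrow> bool" where
  "connects e s f t w \<longleftrightarrow> w \<in> admissible_words G E \<and>
     snd (hd w) = e \<and> sgn (fst (hd w)) = s \<and>
     tau G E (fst (last w)) (snd (last w)) = f \<and> sgn (fst (last w)) = t"

lemma connects_exists:
  assumes "e \<in> E" "f \<in> E" "s \<in> {1, -1}" "t \<in> {1, -1}"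
  shows "\<exists>w. connects e s f t w"
proof -
  \<comment> \<open>Signs alternate, so the end signs differ exactly when the length is
    even.\<close>
  obtain ks where "ks \<noteq> []" "even (length ks) = (t = - s)" "run e ks = f"
    using run_transitive assms(1,2) by metis
  then show ?thesis
    using admissible_word_of_run[OF assms(1,3), of ks] assms(3,4)
    unfolding connects_def by (auto split: if_splits)
qed

lemma connects_admissible:
  assumes "connects (tau G E (fst a) (snd a)) (- sgn (fst a)) (snd b) (- sgn (fst b)) w"
    and a: "a \<in> alphabet E" and b: "b \<in> alphabet E"
  shows "[a] @ w @ [b] \<in> admissible_words G E"
proof -
  have nz: "fst a \<noteq> 0" "fst b \<noteq> 0"
    using a b by (auto simp: alphabet_def)
  have "sgn (fst a * fst (hd w)) = - 1" "sgn (fst (last w) * fst b) = - 1"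
    using assms(1) nz by (auto simp: connects_def sgn_mult linorder_neq_iff)
  then have "follows a (hd w)" "follows (last w) b"
    using assms(1) by (simp_all add: connects_def follows_def sgn_1_neg)
  then show ?thesis
    using assms by (auto simp: connects_def admissible_words_iff successively_Cons
        successively_append_iff)
qed

end

theorem proposition3p1:
  fixes G E :: "(int^2^2) set set"
  assumes "modular_subgroup G"
    and "coset_representatives G E"
  shows "\<exists>W. finite W \<and> W \<subseteq> admissible_words G E \<and>
    (\<forall>a \<in> alphabet E. \<forall>b \<in> alphabet E. \<exists>w \<in> W. [a] @ w @ [b] \<in> admissible_words G E)"
proof -
  interpret modular_coset_space G E
    using assms by unfold_locales
  define word where "word = (\<lambda>(e, s, f, t). SOME w. connects e s f t w)"
  \<comment> \<open>The alphabet is infinite, but \<open>a\<close> matters only through its sign and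
    the representative it leads to, and \<open>b\<close> only through its sign and its own
    representative.\<close>
  define W where "W = word ` (E \<times> {1, -1} \<times> E \<times> {1, -1})"
  have word: "connects e s f t (word (e, s, f, t))"
    if "e \<in> E" "s \<in> {1, -1}" "f \<in> E" "t \<in> {1, -1}" for e s f t
    using someI_ex[OF connects_exists] that by (simp add: word_def)
  have "finite W"
    using finite_E by (simp add: W_def)
  moreover have "W \<subseteq> admissible_words G E"
    using word unfolding W_def connects_def by blast
  moreover have "\<exists>w \<in> W. [a] @ w @ [b] \<in> admissible_words G E"
    if a: "a \<in> alphabet E" and b: "b \<in> alphabet E" for a b
  proof -
    have ends: "tau G E (fst a) (snd a) \<in> E" "- sgn (fst a) \<in> {1, -1}"
        "snd b \<in> E" "- sgn (fst b) \<in> {1, -1}"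
      using a b by (auto simp: alphabet_def sgn_if intro: tau_closed)
    then have "word (tau G E (fst a) (snd a), - sgn (fst a), snd b, - sgn (fst b)) \<in> W"
      unfolding W_def by blast
    then show ?thesis
      using connects_admissible[OF word[OF ends] a b] by blast
  qed
  ultimately show ?thesis
    by blast
qed

end
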